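(* Let $R$ be a commutative ring with identity, let $M$ be a faithful finitely generated coreduced comultiplication $R$-module, and let $N$ be a non-zero submodule of $M$. Then the following are equivalent: (a) $N$ is a $dqz^\circ$-submodule of $M$; (b) for each $a\in Ann_R(N)$ and each submodule $K$ of $M$, $\mathfrak{S}_{(0:_Ma)}=\mathfrak{S}_K$ implies $N\subseteq K$; (c) for each $a\in Ann_R(N)$ and each submodule $K$ of $M$, $V^s((0:_Ma))=V^s(K)$ implies $N\subseteq K$; (d) for each $a\in R$, $a\in Ann_R(N)$ implies $N\subseteq Ann_R(aM)M$; (e) for all $a,b\in R$, $Ann_R(aM)=Ann_R(bM)$ and $a\in Ann_R(N)$ imply $b\in Ann_R(N)$; (f) for all $a,b\in R$, $Ann_R(aM)\subseteq Ann_R(bM)$ and $a\in Ann_R(N)$ imply $b\in Ann_R(N)$.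
   Context: For a submodule $K$ of $M$, an ideal $I$ of $R$ and $r\in R$: $(K:_Mr)=\{m\in M: rm\in K\}$, $(0:_MI)=\{m\in M: Im=0\}$, $(0:_Mr)=\{m\in M: rm=0\}$. $M$ is a comultiplication module if every submodule $N$ of $M$ has the form $N=(0:_MI)$ for some ideal $I$ of $R$. A proper submodule $L$ of $M$ is completely irreducible if $L=\bigcap_{i\in I}N_i$ for a family of submodules $N_i$ of $M$ implies $L=N_i$ for some $i$. $M$ is coreduced if for every $r\in R$ and every completely irreducible submodule $L$ of $M$, $(L:_Mr)=M$ implies $L+(0:_Mr)=M$. A non-zero submodule $S$ of $M$ is second if for each $a\in R$ multiplication by $a$ on $S$ is either surjective or zero. A maximal second submodule of $M$ is a second submodule of $M$ that is maximal under inclusion among the second submodules of $M$. For a submodule $K$ of $M$, $V^s(K)$ is the set of maximal second submodules of $M$ contained in $K$, and $\mathfrak{S}_K$ is the sum of all members of $V^s(K)$ (and $0$ if $V^s(K)=\emptyset$). A non-zero submodule $N$ of $M$ is a $dqz^\circ$-submodule of $M$ if $N\subseteq\mathfrak{S}_{(0:_Ma)}$ for all $a\in Ann_R(N)$. *)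

theory Defs
  imports Complex_Main "HOL-Algebra.Module" "HOL-Algebra.Ideal"
begin

text \<open>Throughout, \<open>R\<close> is a ring and \<open>M\<close> an \<open>R\<close>-module in the sense of the locale
  \<^locale>\<open>module\<close>; ideals and submodules are carrier sets.\<close>

text \<open>\<open>(K :\<^sub>M r)\<close>, \<open>(0 :\<^sub>M r)\<close>, \<open>(0 :\<^sub>M I)\<close> and \<open>Ann\<^sub>R(X)\<close>, respectively.\<close>

definition colon :: "('r, 'm, 'd) module_scheme \<Rightarrow> 'm set \<Rightarrow> 'r \<Rightarrow> 'm set" where
  "colon M K r = {m \<in> carrier M. r \<odot>\<^bsub>M\<^esub> m \<in> K}"

definition zero_colon :: "('r, 'm, 'd) module_scheme \<Rightarrow> 'r \<Rightarrow> 'm set" where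
  "zero_colon M r = {m \<in> carrier M. r \<odot>\<^bsub>M\<^esub> m = \<zero>\<^bsub>M\<^esub>}"

definition zero_colon_ideal :: "('r, 'm, 'd) module_scheme \<Rightarrow> 'r set \<Rightarrow> 'm set" where
  "zero_colon_ideal M I = {m \<in> carrier M. \<forall>r\<in>I. r \<odot>\<^bsub>M\<^esub> m = \<zero>\<^bsub>M\<^esub>}"

definition Ann :: "('r, 'c) ring_scheme \<Rightarrow> ('r, 'm, 'd) module_scheme \<Rightarrow> 'm set \<Rightarrow> 'r set" where
  "Ann R M X = {r \<in> carrier R. \<forall>x\<in>X. r \<odot>\<^bsub>M\<^esub> x = \<zero>\<^bsub>M\<^esub>}"

definition elem_smult :: "('r, 'm, 'd) module_scheme \<Rightarrow> 'r \<Rightarrow> 'm set \<Rightarrow> 'm set" where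
  "elem_smult M a X = (\<lambda>x. a \<odot>\<^bsub>M\<^esub> x) ` X"

definition generated_submodule ::
    "('r, 'c) ring_scheme \<Rightarrow> ('r, 'm, 'd) module_scheme \<Rightarrow> 'm set \<Rightarrow> 'm set" where
  "generated_submodule R M X = (\<lambda>H. submodule H R M) hull X"

text \<open>The product \<open>I M\<close> consists of the finite sums of elements \<open>r m\<close>.\<close>

definition ideal_smult ::
    "('r, 'c) ring_scheme \<Rightarrow> ('r, 'm, 'd) module_scheme \<Rightarrow> 'r set \<Rightarrow> 'm set" where
  "ideal_smult R M I = generated_submodule R M {r \<odot>\<^bsub>M\<^esub> m | r m. r \<in> I \<and> m \<in> carrier M}"

definition finitely_generated ::
    "('r, 'c) ring_scheme \<Rightarrow> ('r, 'm, 'd) module_scheme \<Rightarrow> bool" where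
  "finitely_generated R M \<longleftrightarrow>
     (\<exists>X. finite X \<and> X \<subseteq> carrier M \<and> generated_submodule R M X = carrier M)"

definition faithful :: "('r, 'c) ring_scheme \<Rightarrow> ('r, 'm, 'd) module_scheme \<Rightarrow> bool" where
  "faithful R M \<longleftrightarrow> Ann R M (carrier M) = {\<zero>\<^bsub>R\<^esub>}"

definition comultiplication ::
    "('r, 'c) ring_scheme \<Rightarrow> ('r, 'm, 'd) module_scheme \<Rightarrow> bool" where
  "comultiplication R M \<longleftrightarrow>
     (\<forall>N. submodule N R M \<longrightarrow> (\<exists>I. ideal I R \<and> N = zero_colon_ideal M I))"

text \<open>Intersecting with \<open>carrier M\<close> makes the intersection of the empty family equal to \<open>M\<close>.\<close>

definition completely_irreducible ::
    "('r, 'c) ring_scheme \<Rightarrow> ('r, 'm, 'd) module_scheme \<Rightarrow> 'm set \<Rightarrow> bool" where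
  "completely_irreducible R M L \<longleftrightarrow>
     submodule L R M \<and> L \<noteq> carrier M \<and>
     (\<forall>F. (\<forall>N\<in>F. submodule N R M) \<and> L = carrier M \<inter> \<Inter>F \<longrightarrow> L \<in> F)"

definition coreduced :: "('r, 'c) ring_scheme \<Rightarrow> ('r, 'm, 'd) module_scheme \<Rightarrow> bool" where
  "coreduced R M \<longleftrightarrow>
     (\<forall>r\<in>carrier R. \<forall>L. completely_irreducible R M L \<longrightarrow>
        colon M L r = carrier M \<longrightarrow> L <+>\<^bsub>M\<^esub> zero_colon M r = carrier M)"

definition second_submodule ::
    "('r, 'c) ring_scheme \<Rightarrow> ('r, 'm, 'd) module_scheme \<Rightarrow> 'm set \<Rightarrow> bool" where
  "second_submodule R M S \<longleftrightarrow>
     submodule S R M \<and> S \<noteq> {\<zero>\<^bsub>M\<^esub>} \<and>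
     (\<forall>a\<in>carrier R. elem_smult M a S = S \<or> elem_smult M a S = {\<zero>\<^bsub>M\<^esub>})"

definition maximal_second_submodule ::
    "('r, 'c) ring_scheme \<Rightarrow> ('r, 'm, 'd) module_scheme \<Rightarrow> 'm set \<Rightarrow> bool" where
  "maximal_second_submodule R M S \<longleftrightarrow>
     second_submodule R M S \<and> (\<forall>T. second_submodule R M T \<and> S \<subseteq> T \<longrightarrow> T = S)"

text \<open>\<open>V\<^sup>s(K)\<close>\<close>

definition Vs ::
    "('r, 'c) ring_scheme \<Rightarrow> ('r, 'm, 'd) module_scheme \<Rightarrow> 'm set \<Rightarrow> 'm set set" where
  "Vs R M K = {S. maximal_second_submodule R M S \<and> S \<subseteq> K}"

text \<open>\<open>\<SS>\<^sub>K\<close>: the sum of a family of submodules is the submodule generated by its union. For the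
  empty family this is the zero submodule.\<close>

definition SS ::
    "('r, 'c) ring_scheme \<Rightarrow> ('r, 'm, 'd) module_scheme \<Rightarrow> 'm set \<Rightarrow> 'm set" where
  "SS R M K = generated_submodule R M (\<Union>(Vs R M K))"

definition dqz_submodule ::
    "('r, 'c) ring_scheme \<Rightarrow> ('r, 'm, 'd) module_scheme \<Rightarrow> 'm set \<Rightarrow> bool" where
  "dqz_submodule R M N \<longleftrightarrow>
     submodule N R M \<and> N \<noteq> {\<zero>\<^bsub>M\<^esub>} \<and> (\<forall>a\<in>Ann R M N. N \<subseteq> SS R M (zero_colon M a))"

lemma SS_no_maximal_second:
  assumes "module R M" and "Vs R M K = {}"
  shows "SS R M K = {\<zero>\<^bsub>M\<^esub>}"
proof -
  interpret M: Module.module R M by fact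
  have "submodule {\<zero>\<^bsub>M\<^esub>} R M"
    by (rule M.submoduleI) auto
  moreover have "\<zero>\<^bsub>M\<^esub> \<in> H" if "submodule H R M" for H
    using subgroup.one_closed[OF submodule.axioms(1)[OF that]] by simp
  ultimately show ?thesis
    using assms(2) by (auto simp: SS_def generated_submodule_def hull_def)
qed

end

theory Submission
  imports Defs
begin

text \<open>
  All six conditions hold for every non-zero \<open>N\<close>, because \<open>R\<close> is von Neumann regular. If
  \<open>r M + (0 :\<^sub>M r)\<close> were proper, it would lie in a completely irreducible \<open>L\<close> with
  \<open>L + (0 :\<^sub>M r) = L\<close>, against coreducedness. Hence \<open>r M = r\<^sup>2 M\<close>, and Nakayama together
  with faithfulness gives \<open>r = r\<^sup>2 x\<close>, so \<open>r R\<close> is generated by an idempotent \<open>e\<close>. Then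
  \<open>1 - e\<close> annihilates \<open>r M\<close> and acts as the identity on \<open>(0 :\<^sub>M r)\<close>, which yields (d), (e)
  and (f).

  For (a), (b) and (c) it suffices that \<open>\<SS>\<close> of \<open>(0 :\<^sub>M e)\<close> is \<open>(0 :\<^sub>M e)\<close> itself.
  Otherwise some completely irreducible \<open>L\<close> contains that \<open>\<SS>\<close> and \<open>e M\<close>. By comultiplication
  \<open>L\<close> is an intersection of submodules \<open>(0 :\<^sub>M c)\<close>, hence equal to one of them, so
  \<open>L = (0 :\<^sub>M g)\<close> with \<open>g\<close> idempotent. For an idempotent \<open>h\<close>, \<open>L\<close> is the intersection of
  \<open>(0 :\<^sub>M h g)\<close> and \<open>(0 :\<^sub>M (1 - h) g)\<close>, hence equal to one of the two; this makes \<open>g M\<close> a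
  second submodule, and a maximal one since \<open>g\<close> acts surjectively on any larger one. As
  \<open>g M \<subseteq> (0 :\<^sub>M e)\<close>, it follows that \<open>g M \<subseteq> L = (0 :\<^sub>M g)\<close>, so \<open>g M = 0\<close>, a contradiction.
\<close>

section \<open>Submodules\<close>

context Module.module
begin

lemma submodule_zero_mem: "submodule H R M \<Longrightarrow> \<zero>\<^bsub>M\<^esub> \<in> H"
  using subgroup.one_closed[OF submodule.axioms(1)] by fastforce

lemma submodule_carrier_mem: "submodule H R M \<Longrightarrow> x \<in> H \<Longrightarrow> x \<in> carrier M"
  using submoduleE(1) by blast

lemma submodule_zero: "submodule {\<zero>\<^bsub>M\<^esub>} R M"
  by (rule submoduleI) auto

text \<open>The family must be non-empty because \<open>\<Inter>{}\<close> is the whole type, not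
  \<open>carrier M\<close>.\<close>

lemma submodule_Inter:
  assumes "F \<noteq> {}" and "\<And>H. H \<in> F \<Longrightarrow> submodule H R M"
  shows "submodule (\<Inter>F) R M"
proof (rule submoduleI)
  show "\<Inter>F \<subseteq> carrier M"
    using assms submoduleE(1) by blast
qed (use assms(2) in \<open>auto intro: submodule_zero_mem submoduleE(3,4,5)\<close>)

lemma submodule_colon:
  assumes H: "submodule H R M" and a: "a \<in> carrier R"
  shows "submodule (colon M H a) R M"
proof (rule submoduleI)
  show "r \<odot>\<^bsub>M\<^esub> x \<in> colon M H a" if "r \<in> carrier R" "x \<in> colon M H a" for r x
  proof -
    have "a \<odot>\<^bsub>M\<^esub> (r \<odot>\<^bsub>M\<^esub> x) = r \<odot>\<^bsub>M\<^esub> (a \<odot>\<^bsub>M\<^esub> x)"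
      using that a by (simp add: colon_def R.m_comm flip: smult_assoc1)
    with that a show ?thesis
      by (simp add: colon_def submoduleE(4)[OF H])
  qed
qed (use a in \<open>auto simp: colon_def smult_r_distr smult_r_minus
      intro: submodule_zero_mem[OF H] submoduleE(3,5)[OF H]\<close>)

lemma zero_colon_eq_colon: "zero_colon M a = colon M {\<zero>\<^bsub>M\<^esub>} a"
  by (simp add: zero_colon_def colon_def)

lemma submodule_zero_colon: "a \<in> carrier R \<Longrightarrow> submodule (zero_colon M a) R M"
  by (simp add: zero_colon_eq_colon submodule_colon submodule_zero)

lemma submodule_elem_smult:
  assumes H: "submodule H R M" and a: "a \<in> carrier R"
  shows "submodule (elem_smult M a H) R M"
proof -
  note HM [simp] = submodule_carrier_mem[OF H]
  show ?thesis
  proof (rule submoduleI)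
    show "elem_smult M a H \<subseteq> carrier M"
      using a by (auto simp: elem_smult_def)
    have "\<zero>\<^bsub>M\<^esub> = a \<odot>\<^bsub>M\<^esub> \<zero>\<^bsub>M\<^esub>"
      using a by simp
    then show "\<zero>\<^bsub>M\<^esub> \<in> elem_smult M a H"
      unfolding elem_smult_def using submodule_zero_mem[OF H] by blast
    show "\<ominus>\<^bsub>M\<^esub> x \<in> elem_smult M a H" if prems: "x \<in> elem_smult M a H" for x
    proof -
      obtain y where "y \<in> H" "x = a \<odot>\<^bsub>M\<^esub> y"
        using prems unfolding elem_smult_def by blast
      then show ?thesis
        unfolding elem_smult_def using a submoduleE(3)[OF H]
        by (intro image_eqI[of _ _ "\<ominus>\<^bsub>M\<^esub> y"]) (simp_all add: smult_r_minus)
    qed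
    show "x \<oplus>\<^bsub>M\<^esub> x' \<in> elem_smult M a H"
      if prems: "x \<in> elem_smult M a H" "x' \<in> elem_smult M a H" for x x'
    proof -
      obtain y y' where "y \<in> H" "x = a \<odot>\<^bsub>M\<^esub> y" "y' \<in> H" "x' = a \<odot>\<^bsub>M\<^esub> y'"
        using prems unfolding elem_smult_def by blast
      then show ?thesis
        unfolding elem_smult_def using a submoduleE(5)[OF H]
        by (intro image_eqI[of _ _ "y \<oplus>\<^bsub>M\<^esub> y'"]) (simp_all add: smult_r_distr)
    qed
    show "r \<odot>\<^bsub>M\<^esub> x \<in> elem_smult M a H" if prems: "r \<in> carrier R" "x \<in> elem_smult M a H" for r x
    proof -
      obtain y where "y \<in> H" "x = a \<odot>\<^bsub>M\<^esub> y"
        using prems unfolding elem_smult_def by blast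
      then show ?thesis
        unfolding elem_smult_def using a prems submoduleE(4)[OF H]
        by (intro image_eqI[of _ _ "r \<odot>\<^bsub>M\<^esub> y"]) (simp_all add: R.m_comm flip: smult_assoc1)
    qed
  qed
qed

lemma submodule_set_add:
  assumes H: "submodule H R M" and K: "submodule K R M"
  shows "submodule (H <+>\<^bsub>M\<^esub> K) R M"
proof -
  note [simp] = submodule_carrier_mem[OF H] submodule_carrier_mem[OF K]
  show ?thesis
  proof (rule submoduleI)
    show "H <+>\<^bsub>M\<^esub> K \<subseteq> carrier M"
      by (auto simp: set_add_def')
    have "\<zero>\<^bsub>M\<^esub> = \<zero>\<^bsub>M\<^esub> \<oplus>\<^bsub>M\<^esub> \<zero>\<^bsub>M\<^esub>"
      by simp
    then show "\<zero>\<^bsub>M\<^esub> \<in> H <+>\<^bsub>M\<^esub> K"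
      unfolding set_add_def' using submodule_zero_mem H K by blast
    show "\<ominus>\<^bsub>M\<^esub> x \<in> H <+>\<^bsub>M\<^esub> K" if prems: "x \<in> H <+>\<^bsub>M\<^esub> K" for x
    proof -
      obtain h k where "h \<in> H" "k \<in> K" "x = h \<oplus>\<^bsub>M\<^esub> k"
        using prems unfolding set_add_def' by blast
      then have "\<ominus>\<^bsub>M\<^esub> x = \<ominus>\<^bsub>M\<^esub> h \<oplus>\<^bsub>M\<^esub> \<ominus>\<^bsub>M\<^esub> k" "\<ominus>\<^bsub>M\<^esub> h \<in> H" "\<ominus>\<^bsub>M\<^esub> k \<in> K"
        using submoduleE(3) H K by (auto simp: M.minus_add)
      then show ?thesis
        unfolding set_add_def' by blast
    qed
    show "x \<oplus>\<^bsub>M\<^esub> x' \<in> H <+>\<^bsub>M\<^esub> K" if prems: "x \<in> H <+>\<^bsub>M\<^esub> K" "x' \<in> H <+>\<^bsub>M\<^esub> K" for x x'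
    proof -
      obtain h k h' k' where *: "h \<in> H" "k \<in> K" "x = h \<oplus>\<^bsub>M\<^esub> k"
        "h' \<in> H" "k' \<in> K" "x' = h' \<oplus>\<^bsub>M\<^esub> k'"
        using prems unfolding set_add_def' by blast
      then have "x \<oplus>\<^bsub>M\<^esub> x' = (h \<oplus>\<^bsub>M\<^esub> h') \<oplus>\<^bsub>M\<^esub> (k \<oplus>\<^bsub>M\<^esub> k')"
        by (simp add: M.a_ac)
      moreover have "h \<oplus>\<^bsub>M\<^esub> h' \<in> H" "k \<oplus>\<^bsub>M\<^esub> k' \<in> K"
        using * submoduleE(5) H K by auto
      ultimately show ?thesis
        unfolding set_add_def' by blast
    qed
    show "r \<odot>\<^bsub>M\<^esub> x \<in> H <+>\<^bsub>M\<^esub> K" if prems: "r \<in> carrier R" "x \<in> H <+>\<^bsub>M\<^esub> K" for r x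
    proof -
      obtain h k where "h \<in> H" "k \<in> K" "x = h \<oplus>\<^bsub>M\<^esub> k"
        using prems unfolding set_add_def' by blast
      then have "r \<odot>\<^bsub>M\<^esub> x = r \<odot>\<^bsub>M\<^esub> h \<oplus>\<^bsub>M\<^esub> r \<odot>\<^bsub>M\<^esub> k" "r \<odot>\<^bsub>M\<^esub> h \<in> H" "r \<odot>\<^bsub>M\<^esub> k \<in> K"
        using prems submoduleE(4) H K by (auto simp: smult_r_distr)
      then show ?thesis
        unfolding set_add_def' by blast
    qed
  qed
qed

lemma subset_set_add:
  assumes H: "submodule H R M" and K: "submodule K R M"
  shows "H \<subseteq> H <+>\<^bsub>M\<^esub> K" and "K \<subseteq> H <+>\<^bsub>M\<^esub> K"
proof -
  have "h = h \<oplus>\<^bsub>M\<^esub> \<zero>\<^bsub>M\<^esub>" if "h \<in> H" for h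
    using submodule_carrier_mem[OF H that] by simp
  then show "H \<subseteq> H <+>\<^bsub>M\<^esub> K"
    unfolding set_add_def' using submodule_zero_mem[OF K] by blast
  have "k = \<zero>\<^bsub>M\<^esub> \<oplus>\<^bsub>M\<^esub> k" if "k \<in> K" for k
    using submodule_carrier_mem[OF K that] by simp
  then show "K \<subseteq> H <+>\<^bsub>M\<^esub> K"
    unfolding set_add_def' using submodule_zero_mem[OF H] by blast
qed

lemma set_add_subset:
  assumes "submodule L R M" and "H \<subseteq> L" and "K \<subseteq> L"
  shows "H <+>\<^bsub>M\<^esub> K \<subseteq> L"
  unfolding set_add_def' using assms submoduleE(5) by blast

text \<open>The hull is an intersection over the submodules that contain \<open>X\<close>. Since
  \<open>X\<close> lies in the carrier, the carrier is one of them, so the family is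
  non-empty.\<close>

lemma submodule_generated:
  assumes "X \<subseteq> carrier M"
  shows "submodule (generated_submodule R M X) R M"
  unfolding generated_submodule_def hull_def
  using assms carrier_is_submodule by (intro submodule_Inter) auto

lemma subset_generated: "X \<subseteq> generated_submodule R M X"
  unfolding generated_submodule_def by (rule hull_subset)

lemma generated_subset:
  "submodule H R M \<Longrightarrow> X \<subseteq> H \<Longrightarrow> generated_submodule R M X \<subseteq> H"
  unfolding generated_submodule_def by (rule hull_minimal)

lemma submodule_cyclic:
  assumes x: "x \<in> carrier M"
  shows "submodule ((\<lambda>r. r \<odot>\<^bsub>M\<^esub> x) ` carrier R) R M"
proof (rule submoduleI)
  show "\<zero>\<^bsub>M\<^esub> \<in> (\<lambda>r. r \<odot>\<^bsub>M\<^esub> x) ` carrier R"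
    using x by (intro image_eqI[of _ _ \<zero>]) auto
  show "\<ominus>\<^bsub>M\<^esub> y \<in> (\<lambda>r. r \<odot>\<^bsub>M\<^esub> x) ` carrier R" if "y \<in> (\<lambda>r. r \<odot>\<^bsub>M\<^esub> x) ` carrier R" for y
    using that x by (auto simp flip: smult_l_minus)
  show "y \<oplus>\<^bsub>M\<^esub> z \<in> (\<lambda>r. r \<odot>\<^bsub>M\<^esub> x) ` carrier R"
    if "y \<in> (\<lambda>r. r \<odot>\<^bsub>M\<^esub> x) ` carrier R" "z \<in> (\<lambda>r. r \<odot>\<^bsub>M\<^esub> x) ` carrier R" for y z
    using that x by (auto simp flip: smult_l_distr)
  show "r \<odot>\<^bsub>M\<^esub> y \<in> (\<lambda>r. r \<odot>\<^bsub>M\<^esub> x) ` carrier R"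
    if "r \<in> carrier R" "y \<in> (\<lambda>r. r \<odot>\<^bsub>M\<^esub> x) ` carrier R" for r y
    using that x by (auto simp flip: smult_assoc1)
qed (use x in auto)

text \<open>The sum of \<open>R x\<close> and the submodule generated by \<open>X\<close> already
  contains \<open>insert x X\<close>. This isolates the coefficient of one generator, as the
  elimination below requires.\<close>

lemma generated_insertE:
  assumes "x \<in> carrier M" and "X \<subseteq> carrier M" and "y \<in> generated_submodule R M (insert x X)"
  obtains r z where "r \<in> carrier R" "z \<in> generated_submodule R M X" "y = r \<odot>\<^bsub>M\<^esub> x \<oplus>\<^bsub>M\<^esub> z"
proof -
  let ?C = "(\<lambda>r. r \<odot>\<^bsub>M\<^esub> x) ` carrier R" and ?G = "generated_submodule R M X"
  have sub: "submodule ?C R M" "submodule ?G R M"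
    using assms submodule_cyclic submodule_generated by auto
  have "x \<in> ?C"
    using assms(1) by (intro image_eqI[of _ _ \<one>]) auto
  then have "insert x X \<subseteq> ?C <+>\<^bsub>M\<^esub> ?G"
    using subset_set_add[OF sub] subset_generated[of X] by blast
  then have "y \<in> ?C <+>\<^bsub>M\<^esub> ?G"
    using generated_subset[OF submodule_set_add[OF sub]] assms(3) by blast
  then show thesis
    using that unfolding set_add_def' by blast
qed

lemma smult_minus_distr:
  assumes "a \<in> carrier R" "b \<in> carrier R" "x \<in> carrier M"
  shows "(a \<ominus> b) \<odot>\<^bsub>M\<^esub> x = a \<odot>\<^bsub>M\<^esub> x \<ominus>\<^bsub>M\<^esub> b \<odot>\<^bsub>M\<^esub> x"
  using assms by (simp add: R.minus_eq M.minus_eq smult_l_distr smult_l_minus)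

section \<open>Nakayama's lemma for a principal ideal\<close>

text \<open>With \<open>u = 1 - a c\<close> and \<open>x = a y\<close>, expanding \<open>u y\<close> in the generators gives
  \<open>u x = a (u y) = a r x + \<dots>\<close>, so \<open>u - a r\<close> eliminates the generator \<open>x\<close>; no determinants are
  needed.\<close>

lemma nakayama_elimination:
  assumes "finite X" and Q: "submodule Q R M" and a: "a \<in> carrier R"
    and div: "\<And>q. q \<in> Q \<Longrightarrow> \<exists>q'\<in>Q. q = a \<odot>\<^bsub>M\<^esub> q'"
    and "X \<subseteq> Q" and "c \<in> carrier R"
    and "\<And>q. q \<in> Q \<Longrightarrow> (\<one> \<ominus> a \<otimes> c) \<odot>\<^bsub>M\<^esub> q \<in> generated_submodule R M X"
  shows "\<exists>d\<in>carrier R. \<forall>q\<in>Q. (\<one> \<ominus> a \<otimes> d) \<odot>\<^bsub>M\<^esub> q = \<zero>\<^bsub>M\<^esub>"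
  using assms(1,5-)
proof (induction X arbitrary: c rule: finite_induct)
  case empty
  have "generated_submodule R M {} \<subseteq> {\<zero>\<^bsub>M\<^esub>}"
    by (rule generated_subset[OF submodule_zero]) simp
  with empty show ?case
    by blast
next
  case (insert x X)
  note QM = submodule_carrier_mem[OF Q]
  have xM: "x \<in> carrier M" and XM: "X \<subseteq> carrier M"
    using insert.prems(1) QM by auto
  let ?G = "generated_submodule R M X"
  have G: "submodule ?G R M"
    using XM by (rule submodule_generated)
  note GM = submodule_carrier_mem[OF G]
  define u where "u = \<one> \<ominus> a \<otimes> c"
  have u: "u \<in> carrier R"
    using a insert.prems(2) by (simp add: u_def)
  obtain y where y: "y \<in> Q" "x = a \<odot>\<^bsub>M\<^esub> y"
    using div insert.prems(1) by blast
  obtain r z where r: "r \<in> carrier R" and z: "z \<in> ?G" and uy: "u \<odot>\<^bsub>M\<^esub> y = r \<odot>\<^bsub>M\<^esub> x \<oplus>\<^bsub>M\<^esub> z"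
    using insert.prems(3)[OF y(1)] generated_insertE[OF xM XM] unfolding u_def by metis
  define v where "v = u \<ominus> a \<otimes> r"
  have v: "v \<in> carrier R"
    using u a r by (simp add: v_def)
  have "u \<odot>\<^bsub>M\<^esub> x = a \<odot>\<^bsub>M\<^esub> (u \<odot>\<^bsub>M\<^esub> y)"
    using u a QM[OF y(1)] by (simp add: y(2) R.m_comm flip: smult_assoc1)
  also have "\<dots> = (a \<otimes> r) \<odot>\<^bsub>M\<^esub> x \<oplus>\<^bsub>M\<^esub> a \<odot>\<^bsub>M\<^esub> z"
    using a r xM GM[OF z] by (simp add: uy smult_r_distr smult_assoc1)
  finally have "v \<odot>\<^bsub>M\<^esub> x = a \<odot>\<^bsub>M\<^esub> z"
    using a r u xM GM[OF z]
    by (simp add: v_def smult_minus_distr M.minus_eq M.a_ac M.r_neg M.r_neg1)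
  then have vx: "v \<odot>\<^bsub>M\<^esub> x \<in> ?G"
    using submoduleE(4)[OF G a z] by simp
  \<comment> \<open>Here \<open>v = 1 - a (c + r)\<close> and \<open>u = 1 - a c\<close>;
    multiplying out \<open>v u\<close> and collecting the factor \<open>a\<close> gives this
    \<open>d\<close>.\<close>
  define d where "d = c \<oplus> (c \<oplus> r) \<ominus> (c \<oplus> r) \<otimes> (a \<otimes> c)"
  have d: "d \<in> carrier R"
    using a r insert.prems(2) by (simp add: d_def)
  have vu: "v \<otimes> u = \<one> \<ominus> a \<otimes> d"
    unfolding v_def u_def d_def using a r insert.prems(2) by algebra
  \<comment> \<open>First \<open>u\<close> writes \<open>u q\<close> as \<open>s x + w\<close>, then
    \<open>v\<close> moves the term \<open>s x\<close> into \<open>?G\<close>, because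
    \<open>v x\<close> lies there.\<close>
  have "(\<one> \<ominus> a \<otimes> d) \<odot>\<^bsub>M\<^esub> q \<in> ?G" if q: "q \<in> Q" for q
  proof -
    obtain s w where s: "s \<in> carrier R" and w: "w \<in> ?G" and uq: "u \<odot>\<^bsub>M\<^esub> q = s \<odot>\<^bsub>M\<^esub> x \<oplus>\<^bsub>M\<^esub> w"
      using insert.prems(3)[OF q] generated_insertE[OF xM XM] unfolding u_def by metis
    have "(\<one> \<ominus> a \<otimes> d) \<odot>\<^bsub>M\<^esub> q = v \<odot>\<^bsub>M\<^esub> (s \<odot>\<^bsub>M\<^esub> x \<oplus>\<^bsub>M\<^esub> w)"
      using u v QM[OF q] by (simp add: smult_assoc1 uq flip: vu)
    also have "\<dots> = s \<odot>\<^bsub>M\<^esub> (v \<odot>\<^bsub>M\<^esub> x) \<oplus>\<^bsub>M\<^esub> v \<odot>\<^bsub>M\<^esub> w"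
      using v s xM GM[OF w] by (simp add: smult_r_distr R.m_comm flip: smult_assoc1)
    finally show ?thesis
      using submoduleE(4,5)[OF G] s v vx w by simp
  qed
  then show ?case
    using insert.IH[OF _ d] insert.prems(1) by blast
qed

text \<open>The elimination starts at \<open>c = 0\<close>: the factor \<open>1 - a 0\<close> is the
  identity, and the submodule is generated by all of \<open>X\<close>.\<close>

lemma nakayama_principal:
  assumes "finite X" and "X \<subseteq> carrier M" and a: "a \<in> carrier R"
    and div: "\<And>q. q \<in> generated_submodule R M X \<Longrightarrow>
      \<exists>q'\<in>generated_submodule R M X. q = a \<odot>\<^bsub>M\<^esub> q'"
  shows "\<exists>d\<in>carrier R. \<forall>q\<in>generated_submodule R M X. (\<one> \<ominus> a \<otimes> d) \<odot>\<^bsub>M\<^esub> q = \<zero>\<^bsub>M\<^esub>"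
proof -
  have G: "submodule (generated_submodule R M X) R M"
    using assms(2) by (rule submodule_generated)
  show ?thesis
    by (rule nakayama_elimination[OF assms(1) G a div subset_generated R.zero_closed])
      (auto simp: a R.minus_eq submodule_carrier_mem[OF G])
qed

section \<open>Completely irreducible submodules\<close>

text \<open>By Zorn, take \<open>L\<close> maximal among the submodules that contain
  \<open>K\<close> and avoid a fixed \<open>m\<close> outside \<open>K\<close>. Every strictly
  larger submodule contains \<open>m\<close>, so no intersection of such submodules can equal
  \<open>L\<close>.\<close>

lemma completely_irreducible_exists:
  assumes K: "submodule K R M" and "K \<noteq> carrier M"
  obtains L where "completely_irreducible R M L" and "K \<subseteq> L"
proof -
  obtain m where m: "m \<in> carrier M" "m \<notin> K"
    using assms submoduleE(1) by blast
  let ?A = "{H. submodule H R M \<and> K \<subseteq> H \<and> m \<notin> H}"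
  have "\<exists>L\<in>?A. \<forall>H\<in>?A. L \<subseteq> H \<longrightarrow> H = L"
  proof (rule subset_Zorn_nonempty)
    show "?A \<noteq> {}"
      using K m by blast
  next
    fix C
    assume "C \<noteq> {}" and chain: "subset.chain ?A C"
    then have C: "\<And>H. H \<in> C \<Longrightarrow> submodule H R M \<and> K \<subseteq> H \<and> m \<notin> H"
      and total: "\<And>H H'. H \<in> C \<Longrightarrow> H' \<in> C \<Longrightarrow> H \<subseteq> H' \<or> H' \<subseteq> H"
      unfolding subset_chain_def by blast+
    have "submodule (\<Union>C) R M"
    proof (rule submoduleI)
      show "\<Union>C \<subseteq> carrier M"
        using C submoduleE(1) by blast
      show "\<zero>\<^bsub>M\<^esub> \<in> \<Union>C"
        using \<open>C \<noteq> {}\<close> C submodule_zero_mem by blast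
      show "\<ominus>\<^bsub>M\<^esub> x \<in> \<Union>C" if "x \<in> \<Union>C" for x
        using that C submoduleE(3) by blast
      show "r \<odot>\<^bsub>M\<^esub> x \<in> \<Union>C" if "r \<in> carrier R" "x \<in> \<Union>C" for r x
        using that C submoduleE(4) by blast
      show "x \<oplus>\<^bsub>M\<^esub> y \<in> \<Union>C" if prems: "x \<in> \<Union>C" "y \<in> \<Union>C" for x y
      proof -
        obtain H where "H \<in> C" "x \<in> H" "y \<in> H"
          using prems total by blast
        then show ?thesis
          using C submoduleE(5) by blast
      qed
    qed
    then show "\<Union>C \<in> ?A"
      using \<open>C \<noteq> {}\<close> C by blast
  qed
  then obtain L where "L \<in> ?A" and "\<forall>H\<in>?A. L \<subseteq> H \<longrightarrow> H = L" ..
  then have L: "submodule L R M" "K \<subseteq> L" "m \<notin> L"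
    and max: "\<And>H. submodule H R M \<Longrightarrow> L \<subseteq> H \<Longrightarrow> m \<notin> H \<Longrightarrow> H = L"
    by auto
  have "L \<in> F" if F: "\<forall>H\<in>F. submodule H R M" "L = carrier M \<inter> \<Inter>F" for F
  proof (rule ccontr)
    assume "L \<notin> F"
    have "m \<in> H" if H: "H \<in> F" for H
    proof (rule ccontr)
      assume "m \<notin> H"
      moreover have "L \<subseteq> H"
        using F(2) H by (metis Inter_lower le_infI2)
      ultimately have "H = L"
        using max F(1) H by simp
      with H \<open>L \<notin> F\<close> show False
        by simp
    qed
    \<comment> \<open>Membership of \<open>m\<close> in the carrier is what settles the case of an
      empty \<open>F\<close>.\<close>
    then have "m \<in> L"
      using m(1) by (subst F(2)) simp
    with L(3) show False
      by simp
  qed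
  then have "completely_irreducible R M L"
    unfolding completely_irreducible_def using L m by blast
  with L that show thesis
    by blast
qed

text \<open>The two-member case of the definition; it turns a splitting by complementary idempotents
  into an alternative.\<close>

lemma completely_irreducible_Int:
  assumes "completely_irreducible R M L" and "submodule H R M" and "submodule K R M"
    and "L = H \<inter> K"
  shows "L = H \<or> L = K"
proof -
  have "L = carrier M \<inter> \<Inter>{H, K}"
    using assms submoduleE(1) by auto
  with assms show ?thesis
    unfolding completely_irreducible_def by (metis insertE singletonD)
qed

text \<open>Annihilation by an ideal is annihilation by each of its elements. Passing from the ideal
  to one element makes regularity of \<open>R\<close> applicable to \<open>L\<close>.\<close>

lemma completely_irreducible_eq_zero_colon:
  assumes "comultiplication R M" and L: "completely_irreducible R M L"
  obtains a where "a \<in> carrier R" and "L = zero_colon M a"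
proof -
  have "submodule L R M"
    using L by (simp add: completely_irreducible_def)
  then obtain I where I: "ideal I R" "L = zero_colon_ideal M I"
    using assms(1) unfolding comultiplication_def by blast
  have IR: "I \<subseteq> carrier R"
    using ideal.Icarr[OF I(1)] by blast
  have "L = carrier M \<inter> \<Inter>(zero_colon M ` I)"
    unfolding I(2) zero_colon_ideal_def zero_colon_def by auto
  moreover have "\<forall>H\<in>zero_colon M ` I. submodule H R M"
    using IR submodule_zero_colon by blast
  ultimately have "L \<in> zero_colon M ` I"
    using L unfolding completely_irreducible_def by blast
  with IR that show thesis
    by blast
qed

lemma coreduced_decomposition:
  assumes "coreduced R M" and r: "r \<in> carrier R"
  shows "elem_smult M r (carrier M) <+>\<^bsub>M\<^esub> zero_colon M r = carrier M"
proof (rule ccontr)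
  let ?A = "elem_smult M r (carrier M)" and ?B = "zero_colon M r"
  have A: "submodule ?A R M" and B: "submodule ?B R M"
    using r by (auto intro: submodule_elem_smult submodule_zero_colon carrier_is_submodule)
  assume "?A <+>\<^bsub>M\<^esub> ?B \<noteq> carrier M"
  then obtain L where L: "completely_irreducible R M L" and le: "?A <+>\<^bsub>M\<^esub> ?B \<subseteq> L"
    using completely_irreducible_exists[OF submodule_set_add[OF A B]] by blast
  have sub: "?A \<subseteq> L" "?B \<subseteq> L"
    using le subset_set_add[OF A B] by auto
  have L': "submodule L R M" "L \<noteq> carrier M"
    using L by (auto simp: completely_irreducible_def)
  \<comment> \<open>The inclusion of \<open>r M\<close> in \<open>L\<close> is exactly the premise
    of coreducedness for \<open>L\<close>.\<close>
  have "colon M L r = carrier M"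
    using sub(1) by (auto simp: colon_def elem_smult_def)
  then have "L <+>\<^bsub>M\<^esub> ?B = carrier M"
    using assms L unfolding coreduced_def by blast
  moreover have "L <+>\<^bsub>M\<^esub> ?B \<subseteq> L"
    using L'(1) sub(2) by (intro set_add_subset) auto
  ultimately show False
    using L' submoduleE(1) by blast
qed

section \<open>Von Neumann regularity\<close>

text \<open>Minimality of the hull is used twice: \<open>a\<close> times the hull of
  \<open>X\<close> is a submodule containing \<open>a X\<close>, and the colon by \<open>a\<close>
  of the hull of \<open>a X\<close> is a submodule containing \<open>X\<close>. It provides the
  finite generating set of \<open>a M\<close> that Nakayama needs.\<close>

lemma generated_elem_smult:
  assumes X: "X \<subseteq> carrier M" and a: "a \<in> carrier R"
  shows "generated_submodule R M (elem_smult M a X) = elem_smult M a (generated_submodule R M X)"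
proof
  have aX: "elem_smult M a X \<subseteq> carrier M"
    using X a by (auto simp: elem_smult_def)
  show "generated_submodule R M (elem_smult M a X) \<subseteq> elem_smult M a (generated_submodule R M X)"
    using subset_generated[of X] submodule_generated[OF X] a
    by (intro generated_subset submodule_elem_smult) (auto simp: elem_smult_def)
  have "generated_submodule R M X \<subseteq> colon M (generated_submodule R M (elem_smult M a X)) a"
    using X subset_generated[of "elem_smult M a X"]
    by (intro generated_subset submodule_colon submodule_generated aX a)
      (auto simp: colon_def elem_smult_def)
  then show "elem_smult M a (generated_submodule R M X) \<subseteq> generated_submodule R M (elem_smult M a X)"
    by (auto simp: colon_def elem_smult_def)
qed

text \<open>If \<open>m = y + z\<close> with \<open>y\<close> in \<open>a M\<close> and
  \<open>a z = 0\<close>, then \<open>a m = a y\<close>, so \<open>a\<close> maps \<open>a M\<close>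
  onto itself. Nakayama gives \<open>d\<close> such that \<open>1 - a d\<close> kills
  \<open>a M\<close>, and faithfulness turns this into \<open>(1 - a d) a = 0\<close>.\<close>

lemma coreduced_regular:
  assumes "faithful R M" and "finitely_generated R M" and "coreduced R M" and a: "a \<in> carrier R"
  obtains x where "x \<in> carrier R" and "a = a \<otimes> a \<otimes> x"
proof -
  obtain X where X: "finite X" "X \<subseteq> carrier M" "generated_submodule R M X = carrier M"
    using assms(2) unfolding finitely_generated_def by blast
  have gen: "generated_submodule R M (elem_smult M a X) = elem_smult M a (carrier M)"
    using generated_elem_smult[OF X(2) a] X(3) by simp
  have "\<exists>q'\<in>elem_smult M a (carrier M). q = a \<odot>\<^bsub>M\<^esub> q'" if prems: "q \<in> elem_smult M a (carrier M)" for q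
  proof -
    obtain m where m: "m \<in> carrier M" "q = a \<odot>\<^bsub>M\<^esub> m"
      using prems unfolding elem_smult_def by blast
    obtain y z where "y \<in> elem_smult M a (carrier M)" "z \<in> zero_colon M a" "m = y \<oplus>\<^bsub>M\<^esub> z"
      using m(1) coreduced_decomposition[OF assms(3) a] unfolding set_add_def' by blast
    then show ?thesis
      using m(2) a by (auto simp: elem_smult_def zero_colon_def smult_r_distr)
  qed
  moreover have "finite (elem_smult M a X)" "elem_smult M a X \<subseteq> carrier M"
    using X a by (auto simp: elem_smult_def)
  ultimately obtain d where d: "d \<in> carrier R"
    and ann: "\<And>q. q \<in> elem_smult M a (carrier M) \<Longrightarrow> (\<one> \<ominus> a \<otimes> d) \<odot>\<^bsub>M\<^esub> q = \<zero>\<^bsub>M\<^esub>"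
    using nakayama_principal[of "elem_smult M a X" a] a gen by auto
  have "((\<one> \<ominus> a \<otimes> d) \<otimes> a) \<odot>\<^bsub>M\<^esub> m = \<zero>\<^bsub>M\<^esub>" if "m \<in> carrier M" for m
    using that a d ann[of "a \<odot>\<^bsub>M\<^esub> m"] by (simp add: smult_assoc1 elem_smult_def)
  then have "(\<one> \<ominus> a \<otimes> d) \<otimes> a \<in> Ann R M (carrier M)"
    using a d by (simp add: Ann_def)
  then have "(\<one> \<ominus> a \<otimes> d) \<otimes> a = \<zero>"
    using assms(1) by (simp add: faithful_def)
  moreover have "a = (\<one> \<ominus> a \<otimes> d) \<otimes> a \<oplus> a \<otimes> a \<otimes> d"
    using a d by algebra
  ultimately have "a = a \<otimes> a \<otimes> d"
    using a d by (metis R.l_zero R.m_closed)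
  with d that show thesis
    by blast
qed

text \<open>With \<open>a = a a x\<close>, the product \<open>e = a x\<close> is idempotent. The
  relations \<open>e = a x\<close> and \<open>a = e a\<close> say that \<open>a\<close> and
  \<open>e\<close> generate the same ideal.\<close>

lemma coreduced_idempotent:
  assumes "faithful R M" and "finitely_generated R M" and "coreduced R M" and a: "a \<in> carrier R"
  obtains e x where "e \<in> carrier R" "x \<in> carrier R" "e = a \<otimes> x" "a = e \<otimes> a" "e \<otimes> e = e"
proof -
  obtain x where x: "x \<in> carrier R" "a = a \<otimes> a \<otimes> x"
    using coreduced_regular[OF assms] .
  have "a = (a \<otimes> x) \<otimes> a"
    using a x(1) by (subst x(2)) algebra
  moreover from this have "(a \<otimes> x) \<otimes> (a \<otimes> x) = a \<otimes> x"
    using a x(1) by (metis R.m_assoc R.m_closed)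
  ultimately show thesis
    using that[of "a \<otimes> x" x] a x(1) by simp
qed

lemma idempotent_compl_mult:
  assumes "h \<in> carrier R" and "h \<otimes> h = h"
  shows "(\<one> \<ominus> h) \<otimes> h = \<zero>"
proof -
  have "(\<one> \<ominus> h) \<otimes> h = h \<ominus> h \<otimes> h"
    using assms(1) by algebra
  with assms show ?thesis
    by (simp add: R.minus_eq R.r_neg)
qed

text \<open>Each of \<open>a\<close> and \<open>e\<close> is a multiple of the other, so they kill
  the same elements.\<close>

lemma zero_colon_cong:
  assumes "a \<in> carrier R" "e \<in> carrier R" "x \<in> carrier R" "e = a \<otimes> x" "a = e \<otimes> a"
  shows "zero_colon M a = zero_colon M e"
proof -
  have "e \<odot>\<^bsub>M\<^esub> m = \<zero>\<^bsub>M\<^esub>" if "m \<in> carrier M" "a \<odot>\<^bsub>M\<^esub> m = \<zero>\<^bsub>M\<^esub>" for m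
  proof -
    have "e \<odot>\<^bsub>M\<^esub> m = x \<odot>\<^bsub>M\<^esub> (a \<odot>\<^bsub>M\<^esub> m)"
      using that(1) assms by (simp add: R.m_comm flip: smult_assoc1)
    with that assms(3) show ?thesis
      by simp
  qed
  moreover have "a \<odot>\<^bsub>M\<^esub> m = \<zero>\<^bsub>M\<^esub>" if "m \<in> carrier M" "e \<odot>\<^bsub>M\<^esub> m = \<zero>\<^bsub>M\<^esub>" for m
  proof -
    have "a \<odot>\<^bsub>M\<^esub> m = (a \<otimes> e) \<odot>\<^bsub>M\<^esub> m"
      using assms R.m_comm by metis
    with that assms(1,2) show ?thesis
      by (simp add: smult_assoc1)
  qed
  ultimately show ?thesis
    by (auto simp: zero_colon_def)
qed

section \<open>Maximal second submodules and \<open>\<SS>\<close>\<close>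

text \<open>Let \<open>h\<close> be the idempotent of \<open>b\<close>. Splitting \<open>g\<close>
  into \<open>h g\<close> and \<open>(1 - h) g\<close> leaves two cases: either \<open>1 - h\<close>
  kills \<open>g M\<close>, so that \<open>h = b x\<close> is the identity there and
  \<open>b\<close> is surjective on it, or \<open>h\<close> kills \<open>g M\<close>, and then so
  does \<open>b\<close>.\<close>

lemma second_submodule_idempotent:
  assumes M: "faithful R M" "finitely_generated R M" "coreduced R M"
    and g: "g \<in> carrier R" "g \<otimes> g = g"
    and L: "completely_irreducible R M (zero_colon M g)"
  shows "second_submodule R M (elem_smult M g (carrier M))"
proof -
  let ?S = "elem_smult M g (carrier M)"
  have S: "submodule ?S R M"
    using g(1) carrier_is_submodule by (intro submodule_elem_smult)
  have nz: "?S \<noteq> {\<zero>\<^bsub>M\<^esub>}"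
  proof
    assume "?S = {\<zero>\<^bsub>M\<^esub>}"
    then have "zero_colon M g = carrier M"
      unfolding elem_smult_def zero_colon_def by blast
    with L show False
      by (simp add: completely_irreducible_def)
  qed
  have "elem_smult M b ?S = ?S \<or> elem_smult M b ?S = {\<zero>\<^bsub>M\<^esub>}" if b: "b \<in> carrier R" for b
  proof -
    obtain h x where h: "h \<in> carrier R" "x \<in> carrier R" "h = b \<otimes> x" "b = h \<otimes> b" "h \<otimes> h = h"
      using coreduced_idempotent[OF M b] .
    let ?k = "\<one> \<ominus> h"
    have k: "?k \<in> carrier R" "?k \<otimes> h = \<zero>" "h \<otimes> ?k = \<zero>"
      using h idempotent_compl_mult[of h] by (simp_all add: R.m_comm)
    have split: "y = h \<odot>\<^bsub>M\<^esub> y \<oplus>\<^bsub>M\<^esub> ?k \<odot>\<^bsub>M\<^esub> y" if y: "y \<in> carrier M" for y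
    proof -
      have "h \<oplus> ?k = \<one>"
        using h(1) by algebra
      then show ?thesis
        using h(1) k(1) y by (simp flip: smult_l_distr)
    qed
    have "zero_colon M g = zero_colon M (h \<otimes> g) \<inter> zero_colon M (?k \<otimes> g)"
    proof (intro equalityI subsetI IntI)
      fix m
      assume "m \<in> zero_colon M (h \<otimes> g) \<inter> zero_colon M (?k \<otimes> g)"
      then have m: "m \<in> carrier M" and "h \<odot>\<^bsub>M\<^esub> (g \<odot>\<^bsub>M\<^esub> m) = \<zero>\<^bsub>M\<^esub>" "?k \<odot>\<^bsub>M\<^esub> (g \<odot>\<^bsub>M\<^esub> m) = \<zero>\<^bsub>M\<^esub>"
        using g(1) h(1) k(1) by (auto simp: zero_colon_def smult_assoc1)
      then have "g \<odot>\<^bsub>M\<^esub> m = \<zero>\<^bsub>M\<^esub> \<oplus>\<^bsub>M\<^esub> \<zero>\<^bsub>M\<^esub>"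
        using split[of "g \<odot>\<^bsub>M\<^esub> m"] g(1) by (metis smult_closed)
      with m show "m \<in> zero_colon M g"
        by (simp add: zero_colon_def)
    qed (use g(1) h(1) k(1) in \<open>simp_all add: zero_colon_def smult_assoc1\<close>)
    then have "zero_colon M g = zero_colon M (h \<otimes> g) \<or> zero_colon M g = zero_colon M (?k \<otimes> g)"
      using g(1) h(1) k(1)
      by (intro completely_irreducible_Int[OF L] submodule_zero_colon) simp_all
    then consider "zero_colon M g = zero_colon M (h \<otimes> g)" | "zero_colon M g = zero_colon M (?k \<otimes> g)"
      by blast
    then show ?thesis
    proof cases
      case 1
      have "g \<odot>\<^bsub>M\<^esub> m \<in> elem_smult M b ?S" if m: "m \<in> carrier M" for m
      proof -
        \<comment> \<open>The element \<open>(1 - h) g m\<close> is killed by \<open>h g\<close>,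
          hence by \<open>g\<close> in this case. As \<open>g\<close> fixes it, it is zero.\<close>
        have "(h \<otimes> g) \<odot>\<^bsub>M\<^esub> (?k \<odot>\<^bsub>M\<^esub> (g \<odot>\<^bsub>M\<^esub> m)) = ((h \<otimes> ?k) \<otimes> (g \<otimes> g)) \<odot>\<^bsub>M\<^esub> m"
          using g(1) h(1) k(1) m by (simp add: R.m_ac flip: smult_assoc1)
        then have "?k \<odot>\<^bsub>M\<^esub> (g \<odot>\<^bsub>M\<^esub> m) \<in> zero_colon M (h \<otimes> g)"
          using g h(1) k m by (simp add: zero_colon_def)
        then have "?k \<odot>\<^bsub>M\<^esub> (g \<odot>\<^bsub>M\<^esub> m) \<in> zero_colon M g"
          unfolding 1 .
        then have "(g \<otimes> ?k \<otimes> g) \<odot>\<^bsub>M\<^esub> m = \<zero>\<^bsub>M\<^esub>"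
          using g(1) k(1) m by (simp add: zero_colon_def smult_assoc1)
        moreover have "g \<otimes> ?k \<otimes> g = ?k \<otimes> (g \<otimes> g)"
          using g(1) k(1) by (simp add: R.m_ac)
        ultimately have "?k \<odot>\<^bsub>M\<^esub> (g \<odot>\<^bsub>M\<^esub> m) = \<zero>\<^bsub>M\<^esub>"
          using g k(1) m by (simp add: smult_assoc1)
        then have "g \<odot>\<^bsub>M\<^esub> m = (b \<otimes> x) \<odot>\<^bsub>M\<^esub> (g \<odot>\<^bsub>M\<^esub> m)"
          using split[of "g \<odot>\<^bsub>M\<^esub> m"] g(1) h(1,3) m by simp
        \<comment> \<open>This exhibits \<open>g (x m)\<close> as a preimage of \<open>g m\<close>
          under \<open>b\<close> inside \<open>g M\<close>.\<close>
        also have "\<dots> = b \<odot>\<^bsub>M\<^esub> (g \<odot>\<^bsub>M\<^esub> (x \<odot>\<^bsub>M\<^esub> m))"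
          using b g(1) h(2) m by (simp add: R.m_ac flip: smult_assoc1)
        finally show ?thesis
          using h(2) m unfolding elem_smult_def by blast
      qed
      moreover have "elem_smult M b ?S \<subseteq> ?S"
        using submoduleE(4)[OF S b] by (auto simp: elem_smult_def[of M b])
      ultimately show ?thesis
        by (auto simp: elem_smult_def[of M g])
    next
      case 2
      have "b \<odot>\<^bsub>M\<^esub> (g \<odot>\<^bsub>M\<^esub> m) = \<zero>\<^bsub>M\<^esub>" if m: "m \<in> carrier M" for m
      proof -
        \<comment> \<open>The same argument as in the first case, with \<open>h\<close> and
          \<open>1 - h\<close> exchanged.\<close>
        have "(?k \<otimes> g) \<odot>\<^bsub>M\<^esub> (h \<odot>\<^bsub>M\<^esub> (g \<odot>\<^bsub>M\<^esub> m)) = ((?k \<otimes> h) \<otimes> (g \<otimes> g)) \<odot>\<^bsub>M\<^esub> m"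
          using g(1) h(1) k(1) m by (simp add: R.m_ac flip: smult_assoc1)
        then have "h \<odot>\<^bsub>M\<^esub> (g \<odot>\<^bsub>M\<^esub> m) \<in> zero_colon M (?k \<otimes> g)"
          using g h(1) k m by (simp add: zero_colon_def)
        then have "h \<odot>\<^bsub>M\<^esub> (g \<odot>\<^bsub>M\<^esub> m) \<in> zero_colon M g"
          unfolding 2 .
        then have "(g \<otimes> h \<otimes> g) \<odot>\<^bsub>M\<^esub> m = \<zero>\<^bsub>M\<^esub>"
          using g(1) h(1) m by (simp add: zero_colon_def smult_assoc1)
        moreover have "g \<otimes> h \<otimes> g = h \<otimes> (g \<otimes> g)"
          using g(1) h(1) by (simp add: R.m_ac)
        ultimately have "h \<odot>\<^bsub>M\<^esub> (g \<odot>\<^bsub>M\<^esub> m) = \<zero>\<^bsub>M\<^esub>"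
          using g h(1) m by (simp add: smult_assoc1)
        moreover have "b \<odot>\<^bsub>M\<^esub> (g \<odot>\<^bsub>M\<^esub> m) = (b \<otimes> h) \<odot>\<^bsub>M\<^esub> (g \<odot>\<^bsub>M\<^esub> m)"
          using h(4) R.m_comm[OF b h(1)] by simp
        ultimately show ?thesis
          using b g(1) h(1) m by (simp add: smult_assoc1)
      qed
      then have "elem_smult M b ?S \<subseteq> {\<zero>\<^bsub>M\<^esub>}"
        by (auto simp: elem_smult_def)
      moreover have "\<zero>\<^bsub>M\<^esub> \<in> elem_smult M b ?S"
        by (intro submodule_zero_mem submodule_elem_smult S b)
      ultimately show ?thesis
        by blast
    qed
  qed
  then show ?thesis
    unfolding second_submodule_def using S nz by blast
qed

text \<open>Since \<open>g\<close> is the identity on the non-zero submodule \<open>g M\<close>, it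
  cannot kill a second \<open>T\<close> containing \<open>g M\<close>. Hence \<open>g T = T\<close>,
  which forces \<open>T\<close> into \<open>g M\<close>.\<close>

lemma maximal_second_submodule_idempotent:
  assumes g: "g \<in> carrier R" "g \<otimes> g = g"
    and S: "second_submodule R M (elem_smult M g (carrier M))"
  shows "maximal_second_submodule R M (elem_smult M g (carrier M))"
  unfolding maximal_second_submodule_def
proof (intro conjI S allI impI)
  let ?S = "elem_smult M g (carrier M)"
  fix T
  assume T: "second_submodule R M T \<and> ?S \<subseteq> T"
  then have sub: "submodule T R M"
    by (simp add: second_submodule_def)
  have gg: "g \<odot>\<^bsub>M\<^esub> (g \<odot>\<^bsub>M\<^esub> m) = g \<odot>\<^bsub>M\<^esub> m" if "m \<in> carrier M" for m
    using that g by (simp flip: smult_assoc1)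
  have "elem_smult M g T \<noteq> {\<zero>\<^bsub>M\<^esub>}"
  proof
    assume *: "elem_smult M g T = {\<zero>\<^bsub>M\<^esub>}"
    have "s = \<zero>\<^bsub>M\<^esub>" if s: "s \<in> ?S" for s
    proof -
      have "g \<odot>\<^bsub>M\<^esub> s = s"
        using s gg by (auto simp: elem_smult_def)
      moreover have "g \<odot>\<^bsub>M\<^esub> s \<in> elem_smult M g T"
        using s T by (auto simp: elem_smult_def[of M g T])
      ultimately show ?thesis
        using * by simp
    qed
    moreover have "submodule ?S R M" "?S \<noteq> {\<zero>\<^bsub>M\<^esub>}"
      using S by (auto simp: second_submodule_def)
    ultimately show False
      using submodule_zero_mem by blast
  qed
  then have "elem_smult M g T = T"
    using T g(1) by (auto simp: second_submodule_def)
  then have "T \<subseteq> ?S"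
    using submoduleE(1)[OF sub] unfolding elem_smult_def by blast
  with T show "T = ?S"
    by blast
qed

lemma SS_subset:
  assumes "submodule K R M"
  shows "SS R M K \<subseteq> K"
  unfolding SS_def using assms by (intro generated_subset) (auto simp: Vs_def)

lemma submodule_SS:
  assumes "submodule K R M"
  shows "submodule (SS R M K) R M"
proof -
  have "\<Union>(Vs R M K) \<subseteq> K"
    by (auto simp: Vs_def)
  with submoduleE(1)[OF assms] show ?thesis
    unfolding SS_def by (intro submodule_generated) blast
qed

lemma SS_zero_colon:
  assumes M: "faithful R M" "finitely_generated R M" "coreduced R M" "comultiplication R M"
    and a: "a \<in> carrier R"
  shows "SS R M (zero_colon M a) = zero_colon M a"
proof
  show "SS R M (zero_colon M a) \<subseteq> zero_colon M a"
    using a by (intro SS_subset submodule_zero_colon)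
  obtain e x where e: "e \<in> carrier R" "x \<in> carrier R" "e = a \<otimes> x" "a = e \<otimes> a" "e \<otimes> e = e"
    using coreduced_idempotent[OF M(1,2,3) a] .
  have ae: "zero_colon M a = zero_colon M e"
    using zero_colon_cong[OF a e(1-4)] .
  let ?T = "SS R M (zero_colon M e)" and ?E = "elem_smult M e (carrier M)"
  have K: "submodule (zero_colon M e) R M"
    using e(1) by (rule submodule_zero_colon)
  have T: "submodule ?T R M"
    using K by (rule submodule_SS)
  have E: "submodule ?E R M"
    using e(1) carrier_is_submodule by (intro submodule_elem_smult)
  \<comment> \<open>It is enough that \<open>?T\<close> and \<open>e M\<close> together fill
    \<open>M\<close>, because \<open>e\<close> kills \<open>?T\<close> and is the identity on
    \<open>e M\<close>.\<close>
  have sum: "?T <+>\<^bsub>M\<^esub> ?E = carrier M"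
  proof (rule ccontr)
    assume "?T <+>\<^bsub>M\<^esub> ?E \<noteq> carrier M"
    then obtain L where L: "completely_irreducible R M L" and "?T <+>\<^bsub>M\<^esub> ?E \<subseteq> L"
      using completely_irreducible_exists[OF submodule_set_add[OF T E]] by blast
    then have sub: "?T \<subseteq> L" "?E \<subseteq> L"
      using subset_set_add[OF T E] by auto
    obtain c where c: "c \<in> carrier R" "L = zero_colon M c"
      using completely_irreducible_eq_zero_colon[OF M(4) L] .
    obtain g y where g: "g \<in> carrier R" "y \<in> carrier R" "g = c \<otimes> y" "c = g \<otimes> c" "g \<otimes> g = g"
      using coreduced_idempotent[OF M(1,2,3) c(1)] .
    have Lg: "L = zero_colon M g"
      using zero_colon_cong[OF c(1) g(1-4)] c(2) by simp
    let ?S = "elem_smult M g (carrier M)"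
    have "maximal_second_submodule R M ?S"
      using L Lg g M by (intro maximal_second_submodule_idempotent second_submodule_idempotent) auto
    \<comment> \<open>The inclusion of \<open>e M\<close> in \<open>L\<close> says that
      \<open>g e\<close> kills \<open>M\<close>; by commutativity \<open>e\<close> kills
      \<open>g M\<close>.\<close>
    moreover have "?S \<subseteq> zero_colon M e"
    proof -
      have "e \<odot>\<^bsub>M\<^esub> (g \<odot>\<^bsub>M\<^esub> m) = \<zero>\<^bsub>M\<^esub>" if m: "m \<in> carrier M" for m
      proof -
        have "e \<odot>\<^bsub>M\<^esub> m \<in> zero_colon M g"
          using sub(2) m unfolding Lg elem_smult_def by blast
        then have "g \<odot>\<^bsub>M\<^esub> (e \<odot>\<^bsub>M\<^esub> m) = \<zero>\<^bsub>M\<^esub>"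
          by (simp add: zero_colon_def)
        then show ?thesis
          using e(1) g(1) m by (simp add: R.m_comm flip: smult_assoc1)
      qed
      then show ?thesis
        using g(1) by (auto simp: elem_smult_def zero_colon_def)
    qed
    ultimately have "?S \<in> Vs R M (zero_colon M e)"
      by (simp add: Vs_def)
    then have "?S \<subseteq> ?T"
      using subset_generated[of "\<Union>(Vs R M (zero_colon M e))"] unfolding SS_def by blast
    with sub(1) have SL: "?S \<subseteq> zero_colon M g"
      unfolding Lg by blast
    have "g \<odot>\<^bsub>M\<^esub> m = \<zero>\<^bsub>M\<^esub>" if m: "m \<in> carrier M" for m
    proof -
      have "g \<odot>\<^bsub>M\<^esub> m \<in> zero_colon M g"
        using SL m unfolding elem_smult_def by blast
      then have "(g \<otimes> g) \<odot>\<^bsub>M\<^esub> m = \<zero>\<^bsub>M\<^esub>"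
        using g(1) m by (simp add: zero_colon_def smult_assoc1)
      then show ?thesis
        using g(5) by simp
    qed
    then have "L = carrier M"
      unfolding Lg by (auto simp: zero_colon_def)
    with L show False
      by (simp add: completely_irreducible_def)
  qed
  \<comment> \<open>Write \<open>z = t + e m\<close>. Applying \<open>e\<close> kills
    \<open>z\<close> and \<open>t\<close>, which leaves \<open>e m = 0\<close>, so
    \<open>z = t\<close>.\<close>
  have "z \<in> ?T" if z: "z \<in> zero_colon M e" for z
  proof -
    have "z \<in> ?T <+>\<^bsub>M\<^esub> ?E"
      unfolding sum using z by (simp add: zero_colon_def)
    then obtain t m where t: "t \<in> ?T" and m: "m \<in> carrier M" and ztm: "z = t \<oplus>\<^bsub>M\<^esub> e \<odot>\<^bsub>M\<^esub> m"
      unfolding set_add_def' elem_smult_def by blast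
    have tM: "t \<in> carrier M" and "e \<odot>\<^bsub>M\<^esub> t = \<zero>\<^bsub>M\<^esub>"
      using t SS_subset[OF K] by (auto simp: zero_colon_def)
    then have "e \<odot>\<^bsub>M\<^esub> z = (e \<otimes> e) \<odot>\<^bsub>M\<^esub> m"
      using e(1) m unfolding ztm by (simp add: smult_r_distr smult_assoc1)
    then have "e \<odot>\<^bsub>M\<^esub> m = \<zero>\<^bsub>M\<^esub>"
      using z e(5) by (simp add: zero_colon_def)
    with t tM show ?thesis
      by (simp add: ztm)
  qed
  then show "zero_colon M a \<subseteq> SS R M (zero_colon M a)"
    unfolding ae by blast
qed

section \<open>Verification of the individual conditions for a given submodule\<close>

lemma subset_zero_colon:
  assumes "submodule N R M" and "a \<in> Ann R M N"
  shows "N \<subseteq> zero_colon M a"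
  using assms submoduleE(1)[OF assms(1)] by (auto simp: Ann_def zero_colon_def)

lemma dqz_submodule_coreduced:
  assumes "faithful R M" "finitely_generated R M" "coreduced R M" "comultiplication R M"
    and "submodule N R M" and "N \<noteq> {\<zero>\<^bsub>M\<^esub>}"
  shows "dqz_submodule R M N"
  unfolding dqz_submodule_def
  using assms subset_zero_colon SS_zero_colon by (simp add: Ann_def)

text \<open>The witness is \<open>f = 1 - e\<close> for the idempotent \<open>e\<close> of
  \<open>a\<close>: it kills \<open>a M\<close> because \<open>e a = a\<close>, and it fixes
  \<open>N\<close> because \<open>e\<close> kills whatever \<open>a\<close> kills. This one element
  serves (d), (e) and (f).\<close>

lemma coreduced_Ann_fix:
  assumes M: "faithful R M" "finitely_generated R M" "coreduced R M"
    and N: "submodule N R M" and a: "a \<in> Ann R M N"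
  obtains f where "f \<in> Ann R M (elem_smult M a (carrier M))"
    and "\<And>n. n \<in> N \<Longrightarrow> f \<odot>\<^bsub>M\<^esub> n = n"
proof -
  have aR: "a \<in> carrier R"
    using a by (simp add: Ann_def)
  obtain e x where e: "e \<in> carrier R" "x \<in> carrier R" "e = a \<otimes> x" "a = e \<otimes> a" "e \<otimes> e = e"
    using coreduced_idempotent[OF M aR] .
  show thesis
  proof
    have "(\<one> \<ominus> e) \<odot>\<^bsub>M\<^esub> (a \<odot>\<^bsub>M\<^esub> m) = \<zero>\<^bsub>M\<^esub>" if m: "m \<in> carrier M" for m
    proof -
      have "e \<odot>\<^bsub>M\<^esub> (a \<odot>\<^bsub>M\<^esub> m) = a \<odot>\<^bsub>M\<^esub> m"
        using m aR e(1,4) by (metis smult_assoc1)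
      then show ?thesis
        using m aR e(1) by (simp add: smult_minus_distr M.minus_eq M.r_neg)
    qed
    then show "\<one> \<ominus> e \<in> Ann R M (elem_smult M a (carrier M))"
      using e(1) by (auto simp: Ann_def elem_smult_def)
    fix n
    assume n: "n \<in> N"
    then have nM: "n \<in> carrier M" and "n \<in> zero_colon M e"
      using subset_zero_colon[OF N a] zero_colon_cong[OF aR e(1-4)]
      by (auto simp: zero_colon_def)
    then show "(\<one> \<ominus> e) \<odot>\<^bsub>M\<^esub> n = n"
      using e(1) by (simp add: smult_minus_distr zero_colon_def M.minus_eq)
  qed
qed

text \<open>Each \<open>n = f n\<close> is itself one of the generators of the product.\<close>

lemma subset_ideal_smult_Ann:
  assumes M: "faithful R M" "finitely_generated R M" "coreduced R M"
    and N: "submodule N R M" and a: "a \<in> Ann R M N"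
  shows "N \<subseteq> ideal_smult R M (Ann R M (elem_smult M a (carrier M)))" (is "N \<subseteq> ideal_smult R M ?I")
proof
  fix n
  assume n: "n \<in> N"
  obtain f where "f \<in> ?I" and f: "\<And>n. n \<in> N \<Longrightarrow> f \<odot>\<^bsub>M\<^esub> n = n"
    using coreduced_Ann_fix[OF assms] by blast
  then have "f \<odot>\<^bsub>M\<^esub> n \<in> {r \<odot>\<^bsub>M\<^esub> m | r m. r \<in> ?I \<and> m \<in> carrier M}"
    using submodule_carrier_mem[OF N n] by blast
  then have "n \<in> {r \<odot>\<^bsub>M\<^esub> m | r m. r \<in> ?I \<and> m \<in> carrier M}"
    unfolding f[OF n] .
  then show "n \<in> ideal_smult R M ?I"
    unfolding ideal_smult_def by (rule subsetD[OF subset_generated])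
qed

text \<open>The inclusion makes \<open>f\<close> kill \<open>b M\<close> as well, so
  \<open>b n = b (f n) = f (b n) = 0\<close>.\<close>

lemma Ann_mem_of_Ann_subset:
  assumes M: "faithful R M" "finitely_generated R M" "coreduced R M"
    and N: "submodule N R M" and a: "a \<in> Ann R M N" and b: "b \<in> carrier R"
    and sub: "Ann R M (elem_smult M a (carrier M)) \<subseteq> Ann R M (elem_smult M b (carrier M))"
  shows "b \<in> Ann R M N"
proof -
  obtain f where fa: "f \<in> Ann R M (elem_smult M a (carrier M))"
    and f: "\<And>n. n \<in> N \<Longrightarrow> f \<odot>\<^bsub>M\<^esub> n = n"
    using coreduced_Ann_fix[OF M N a] by blast
  have fb: "f \<in> Ann R M (elem_smult M b (carrier M))" and fR: "f \<in> carrier R"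
    using fa sub by (auto simp: Ann_def)
  have "b \<odot>\<^bsub>M\<^esub> n = \<zero>\<^bsub>M\<^esub>" if n: "n \<in> N" for n
  proof -
    have nM: "n \<in> carrier M"
      using submodule_carrier_mem[OF N n] .
    have "b \<odot>\<^bsub>M\<^esub> n = b \<odot>\<^bsub>M\<^esub> (f \<odot>\<^bsub>M\<^esub> n)"
      using f[OF n] by simp
    also have "\<dots> = f \<odot>\<^bsub>M\<^esub> (b \<odot>\<^bsub>M\<^esub> n)"
      using b fR nM by (simp add: R.m_comm flip: smult_assoc1)
    also have "\<dots> = \<zero>\<^bsub>M\<^esub>"
      using fb nM by (simp add: Ann_def elem_smult_def)
    finally show ?thesis .
  qed
  with b show ?thesis
    by (simp add: Ann_def)
qed

end

theorem theorem4p10: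
  fixes R :: "('r, 'c) ring_scheme" and M :: "('r, 'm, 'd) module_scheme" and N :: "'m set"
  assumes "module R M"
    and "faithful R M"
    and "finitely_generated R M"
    and "coreduced R M"
    and "comultiplication R M"
    and "submodule N R M"
    and "N \<noteq> {\<zero>\<^bsub>M\<^esub>}"
  shows
    "(dqz_submodule R M N \<longleftrightarrow>
        (\<forall>a\<in>Ann R M N. \<forall>K. submodule K R M \<longrightarrow>
           SS R M (zero_colon M a) = SS R M K \<longrightarrow> N \<subseteq> K)) \<and>
     (dqz_submodule R M N \<longleftrightarrow>
        (\<forall>a\<in>Ann R M N. \<forall>K. submodule K R M \<longrightarrow>
           Vs R M (zero_colon M a) = Vs R M K \<longrightarrow> N \<subseteq> K)) \<and>
     (dqz_submodule R M N \<longleftrightarrow>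
        (\<forall>a\<in>carrier R. a \<in> Ann R M N \<longrightarrow>
           N \<subseteq> ideal_smult R M (Ann R M (elem_smult M a (carrier M))))) \<and>
     (dqz_submodule R M N \<longleftrightarrow>
        (\<forall>a\<in>carrier R. \<forall>b\<in>carrier R.
           Ann R M (elem_smult M a (carrier M)) = Ann R M (elem_smult M b (carrier M)) \<longrightarrow>
           a \<in> Ann R M N \<longrightarrow> b \<in> Ann R M N)) \<and>
     (dqz_submodule R M N \<longleftrightarrow>
        (\<forall>a\<in>carrier R. \<forall>b\<in>carrier R.
           Ann R M (elem_smult M a (carrier M)) \<subseteq> Ann R M (elem_smult M b (carrier M)) \<longrightarrow>
           a \<in> Ann R M N \<longrightarrow> b \<in> Ann R M N))"
proof -
  interpret M: Module.module R M by fact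
  note M = assms(2-4)
  note N = assms(6)
  have dqz: "dqz_submodule R M N"
    using M.dqz_submodule_coreduced assms(2-) by blast
  have SS: "N \<subseteq> SS R M (zero_colon M a)" if "a \<in> Ann R M N" for a
    using dqz that by (simp add: dqz_submodule_def)
  have b: "N \<subseteq> K"
    if "a \<in> Ann R M N" "submodule K R M" "SS R M (zero_colon M a) = SS R M K" for a K
    using SS[OF that(1)] M.SS_subset[OF that(2)] that(3) by simp
  \<comment> \<open>The submodule \<open>SS R M K\<close> depends on \<open>K\<close> only through
    \<open>Vs R M K\<close>, so (c) reduces to (b).\<close>
  have c: "N \<subseteq> K"
    if "a \<in> Ann R M N" "submodule K R M" "Vs R M (zero_colon M a) = Vs R M K" for a K
    using b[OF that(1,2)] that(3) by (simp add: SS_def)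
  \<comment> \<open>Each equivalence joins two statements that both hold. Condition (e) is the
    instance of (f) in which the two annihilators are equal.\<close>
  show ?thesis
    using dqz b c M.subset_ideal_smult_Ann[OF M N] M.Ann_mem_of_Ann_subset[OF M N] by simp
qed

end
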